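(* Let $H_t(z)\in k[[t]]\langle\langle z\rangle\rangle^{\times n}$ with $o(H_t(z))\ge 2$, let $F_t(z)=z-H_t(z)$, let $G_t(z)$ be the inverse map of $F_t(z)$, and let $M_t(z)=G_t(z)-z$. Then $$M_t=H_t(G_t),\qquad H_t=M_t(F_t),$$ $$\frac{\partial H_t}{\partial t}(z)=\left[\frac{\partial M_t}{\partial t}(F_t)\frac{\partial}{\partial z}\right]F_t(z),\qquad \frac{\partial M_t}{\partial t}(z)=\left[\frac{\partial H_t}{\partial t}(G_t)\frac{\partial}{\partial z}\right]G_t(z).$$
   Context: $k$ is a (commutative) unital integral domain of any characteristic; $n\ge 1$; $z=(z_1,\dots,z_n)$ are noncommutative free variables; $t$ is a formal parameter commuting with $z$. $k[[t]]\langle\langle z\rangle\rangle$ is the algebra of formal power series in the noncommuting variables $z_i$ over $k[[t]]$. The order $o(U)$ of a vector $U$ is the minimum of the orders (lowest degree in $z$; $t$ counts as a scalar) of its components. An automorphism of $k[[t]]\langle\langle z\rangle\rangle$ over $k[[t]]$ is identified with the vector $F_t=(F_{t,1},\dots,F_{t,n})$ of images of $z_1,\dots,z_n$, and $u(F_t)$ denotes the image of $u$, i.e. the result of substituting $F_{t,i}$ for $z_i$; for vectors this is done componentwise. If $o(H_t)\ge 2$, then $z-H_t$ is an automorphism; its inverse map $G_t$ satisfies $F_t(G_t(z))=z=G_t(F_t(z))$. For a vector $\vec u=(u_1,\dots,u_n)$ over $k[[t]]\langle\langle z\rangle\rangle$, $[\vec u\frac{\partial}{\partial z}]$ denotes the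 unique $k[[t]]$-derivation of $k[[t]]\langle\langle z\rangle\rangle$ sending $z_i$ to $u_i$ for all $i$; applied to a vector it acts componentwise. $\frac{\partial}{\partial t}$ is the derivation of $k[[t]]\langle\langle z\rangle\rangle$ extending $\frac{\partial}{\partial t}$ on $k[[t]]$ coefficientwise, with $\frac{\partial z_i}{\partial t}=0$; it acts on vectors componentwise. *)

theory Defs
  imports
    "HOL-Analysis.Finite_Cartesian_Product"
    "HOL-Computational_Algebra.Formal_Power_Series"
    "HOL-Library.Extended_Nat"
begin

(* Formal power series in noncommuting variables indexed by 'n, with coefficients in 'a
   (which commute with the variables): a series is its family of coefficients, indexed by
   the monomials, i.e. the words over 'n. *)

typedef ('a, 'n) ncps = "UNIV :: ('n list \<Rightarrow> 'a) set"
  morphisms ncps_coeff Abs_ncps ..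

setup_lifting type_definition_ncps

lemma ncps_eqI: "(\<And>w. ncps_coeff f w = ncps_coeff g w) \<Longrightarrow> f = g"
  by transfer auto

instantiation ncps :: (comm_ring_1, type) ring_1
begin

lift_definition zero_ncps :: "('a, 'b) ncps" is "\<lambda>_. 0" .

lift_definition one_ncps :: "('a, 'b) ncps" is "\<lambda>w. if w = [] then 1 else 0" .

lift_definition plus_ncps :: "('a, 'b) ncps \<Rightarrow> ('a, 'b) ncps \<Rightarrow> ('a, 'b) ncps"
  is "\<lambda>f g w. f w + g w" .

lift_definition minus_ncps :: "('a, 'b) ncps \<Rightarrow> ('a, 'b) ncps \<Rightarrow> ('a, 'b) ncps"
  is "\<lambda>f g w. f w - g w" .

lift_definition uminus_ncps :: "('a, 'b) ncps \<Rightarrow> ('a, 'b) ncps"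
  is "\<lambda>f w. - f w" .

lift_definition times_ncps :: "('a, 'b) ncps \<Rightarrow> ('a, 'b) ncps \<Rightarrow> ('a, 'b) ncps"
  is "\<lambda>f g w. \<Sum>i = 0..length w. f (take i w) * g (drop i w)" .

instance
proof
  fix a b c :: "('a, 'b) ncps"
  show "(a * b) * c = a * (b * c)"
  proof transfer
    fix a b c :: "'b list \<Rightarrow> 'a"
    show "(\<lambda>w. \<Sum>j = 0..length w.
             (\<Sum>i = 0..length (take j w). a (take i (take j w)) * b (drop i (take j w))) * c (drop j w)) =
          (\<lambda>w. \<Sum>i = 0..length w.
             a (take i w) *
             (\<Sum>d = 0..length (drop i w). b (take d (drop i w)) * c (drop d (drop i w))))"
    proof
      fix w :: "'b list"
      define h where "h i d (m :: nat) = a (take i w) * b (take d (drop i w)) * c (drop (d + i) w)"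
        for i d m
      have "(\<Sum>j = 0..length w. \<Sum>i = 0..j. h i (j - i) (length w - j)) =
            (\<Sum>j = 0..length w. \<Sum>i = 0..length w - j. h j i (length w - j - i))"
        by (rule fps_mult_assoc_lemma)
      moreover have "(\<Sum>i = 0..length (take j w). a (take i (take j w)) * b (drop i (take j w))) * c (drop j w) =
            (\<Sum>i = 0..j. h i (j - i) (length w - j))" if "j \<in> {0..length w}" for j
        using that unfolding h_def sum_distrib_right
        by (intro sum.cong) (auto simp: drop_take min_def)
      moreover have "a (take i w) * (\<Sum>d = 0..length (drop i w). b (take d (drop i w)) * c (drop d (drop i w))) =
            (\<Sum>d = 0..length w - i. h i d (length w - i - d))" for i
        by (simp add: h_def sum_distrib_left mult.assoc)
      ultimately show "(\<Sum>j = 0..length w.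
             (\<Sum>i = 0..length (take j w). a (take i (take j w)) * b (drop i (take j w))) * c (drop j w)) =
           (\<Sum>i = 0..length w.
             a (take i w) *
             (\<Sum>d = 0..length (drop i w). b (take d (drop i w)) * c (drop d (drop i w))))"
        by simp
    qed
  qed
  show "1 * a = a"
  proof transfer
    fix a :: "'b list \<Rightarrow> 'a"
    have "(\<Sum>i = 0..length w. (if take i w = [] then 1 else 0) * a (drop i w)) = a w" for w
    proof -
      have "(\<Sum>i = 0..length w. (if take i w = [] then 1 else 0) * a (drop i w)) =
            (\<Sum>i = 0..length w. if i = 0 then a w else 0)"
        by (rule sum.cong) auto
      then show ?thesis by simp
    qed
    then show "(\<lambda>w. \<Sum>i = 0..length w. (if take i w = [] then 1 else 0) * a (drop i w)) = a"
      by blast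
  qed
  show "a * 1 = a"
  proof transfer
    fix a :: "'b list \<Rightarrow> 'a"
    have "(\<Sum>i = 0..length w. a (take i w) * (if drop i w = [] then 1 else 0)) = a w" for w
    proof -
      have "(\<Sum>i = 0..length w. a (take i w) * (if drop i w = [] then 1 else 0)) =
            (\<Sum>i = 0..length w. if i = length w then a w else 0)"
        by (rule sum.cong) auto
      then show ?thesis by simp
    qed
    then show "(\<lambda>w. \<Sum>i = 0..length w. a (take i w) * (if drop i w = [] then 1 else 0)) = a"
      by blast
  qed
  show "(a + b) * c = a * c + b * c"
    by transfer (simp add: distrib_right sum.distrib)
  show "a * (b + c) = a * b + a * c"
    by transfer (simp add: distrib_left sum.distrib)
  show "(0 :: ('a, 'b) ncps) \<noteq> 1"
    by transfer (metis zero_neq_one)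
qed (transfer; simp add: fun_eq_iff add.assoc add.commute)+

end

lift_definition ncps_const :: "'a::comm_ring_1 \<Rightarrow> ('a, 'n) ncps"
  is "\<lambda>c w. if w = [] then c else 0" .

lift_definition ncps_var :: "'n \<Rightarrow> ('a::comm_ring_1, 'n) ncps"
  is "\<lambda>i w. if w = [i] then 1 else 0" .

definition ncps_vars :: "('a::comm_ring_1, 'n::finite) ncps ^ 'n"
  where "ncps_vars = (\<chi> i. ncps_var i)"

(* The order of 0 is \<infinity>. *)

definition ncps_order :: "('a::comm_ring_1, 'n) ncps \<Rightarrow> enat"
  where "ncps_order f = (INF w \<in> {w. ncps_coeff f w \<noteq> 0}. enat (length w))"

definition ncps_vec_order :: "('a::comm_ring_1, 'n) ncps ^ 'm::finite \<Rightarrow> enat"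
  where "ncps_vec_order U = Min (range (\<lambda>i. ncps_order (U $ i)))"

(* Substitution u(F) = \<Sum>w. (coefficient of w in u) * F_w, where F_w = F_{w_1} ... F_{w_m}.
   It is meant for vectors F of order at least 1; then F_w has order at least length w, so that
   only words w of length at most length v contribute to the coefficient of v. *)

definition ncps_subst ::
    "('a::comm_ring_1, 'n::finite) ncps \<Rightarrow> ('a, 'n) ncps ^ 'n \<Rightarrow> ('a, 'n) ncps"
  where "ncps_subst u F = Abs_ncps (\<lambda>v. \<Sum>w | length w \<le> length v.
           ncps_coeff u w * ncps_coeff (prod_list (map (\<lambda>i. F $ i) w)) v)"

definition ncps_vec_subst ::
    "('a::comm_ring_1, 'n::finite) ncps ^ 'm::finite \<Rightarrow> ('a, 'n) ncps ^ 'n \<Rightarrow> ('a, 'n) ncps ^ 'm"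
  where "ncps_vec_subst U F = (\<chi> i. ncps_subst (U $ i) F)"

(* The condition on the order of G ensures that substituting G is meaningful. The inverse map
   exists and is unique when F = z - H with H of order at least 2. *)

definition is_inverse_map ::
    "('a::comm_ring_1, 'n::finite) ncps ^ 'n \<Rightarrow> ('a, 'n) ncps ^ 'n \<Rightarrow> bool"
  where "is_inverse_map F G \<longleftrightarrow>
    ncps_vec_order G \<ge> 1 \<and> ncps_vec_subst F G = ncps_vars \<and> ncps_vec_subst G F = ncps_vars"

definition inverse_map ::
    "('a::comm_ring_1, 'n::finite) ncps ^ 'n \<Rightarrow> ('a, 'n) ncps ^ 'n"
  where "inverse_map F = (THE G. is_inverse_map F G)"

(* Derivations over the coefficient ring *)

definition ncps_is_derivation :: "(('a::comm_ring_1, 'n) ncps \<Rightarrow> ('a, 'n) ncps) \<Rightarrow> bool"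
  where "ncps_is_derivation D \<longleftrightarrow>
    (\<forall>f g. D (f + g) = D f + D g) \<and>
    (\<forall>c f. D (ncps_const c * f) = ncps_const c * D f) \<and>
    (\<forall>f g. D (f * g) = D f * g + f * D g)"

(* [u d/dz]: for finitely many variables, the values on the variables determine a derivation of
   the whole power series algebra, as any derivation lowers the order by at most 1; and every
   vector u of values occurs. *)

definition ncps_derivation ::
    "('a::comm_ring_1, 'n::finite) ncps ^ 'n \<Rightarrow> ('a, 'n) ncps \<Rightarrow> ('a, 'n) ncps"
  where "ncps_derivation u =
    (THE D. ncps_is_derivation D \<and> (\<forall>i. D (ncps_var i) = u $ i))"

definition ncps_vec_derivation ::
    "('a::comm_ring_1, 'n::finite) ncps ^ 'n \<Rightarrow> ('a, 'n) ncps ^ 'm::finite \<Rightarrow> ('a, 'n) ncps ^ 'm"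
  where "ncps_vec_derivation u V = (\<chi> i. ncps_derivation u (V $ i))"

(* d/dt on k[[t]]<<z>> *)

lift_definition ncps_deriv_t :: "('k::idom fps, 'n) ncps \<Rightarrow> ('k fps, 'n) ncps"
  is "\<lambda>f w. fps_deriv (f w)" .

definition ncps_vec_deriv_t ::
    "('k::idom fps, 'n) ncps ^ 'm::finite \<Rightarrow> ('k fps, 'n) ncps ^ 'm"
  where "ncps_vec_deriv_t U = (\<chi> i. ncps_deriv_t (U $ i))"

end

theory Submission
  imports Defs
begin

text \<open>
  Additive maps that are continuous in the \<open>z\<close>-adic topology are determined by their values on
  the terms \<open>c w\<close> with \<open>c\<close> a scalar and \<open>w\<close> a word; this gives multiplicativity and associativity
  of substitution and existence and uniqueness of \<open>[u \<partial>/\<partial>z]\<close>. The inverse map of \<open>z - H\<close> is the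
  fixed point of the contraction \<open>G \<mapsto> z + H(G)\<close>. The same density argument yields the chain rule
  \<open>\<partial>/\<partial>t (f(G)) = (\<partial>f/\<partial>t)(G) + ([u \<partial>/\<partial>z] f)(G)\<close> whenever \<open>u(G) = \<partial>G/\<partial>t\<close>. Applied with
  \<open>u = (\<partial>G/\<partial>t)(F)\<close> to \<open>F(G) = z\<close> it gives the formula for \<open>\<partial>H/\<partial>t\<close>, and symmetrically for
  \<open>\<partial>M/\<partial>t\<close>.
\<close>

section \<open>Coefficients and order\<close>

declare plus_ncps.rep_eq [simp] minus_ncps.rep_eq [simp] uminus_ncps.rep_eq [simp]
  zero_ncps.rep_eq [simp]

lemma ncps_coeff_sum [simp]: "ncps_coeff (sum f A) w = (\<Sum>x\<in>A. ncps_coeff (f x) w)"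
  by (induction A rule: infinite_finite_induct) auto

lemma ncps_coeff_const_mult [simp]: "ncps_coeff (ncps_const c * f) w = c * ncps_coeff f w"
proof -
  have "ncps_coeff (ncps_const c * f) w =
      (\<Sum>i = 0..length w. if i = 0 then c * ncps_coeff f w else 0)"
    unfolding times_ncps.rep_eq ncps_const.rep_eq by (rule sum.cong) auto
  then show ?thesis by simp
qed

lemma ncps_coeff_mult_const: "ncps_coeff (f * ncps_const c) w = c * ncps_coeff f w"
proof -
  have "ncps_coeff (f * ncps_const c) w =
      (\<Sum>i = 0..length w. if i = length w then c * ncps_coeff f w else 0)"
    unfolding times_ncps.rep_eq ncps_const.rep_eq by (rule sum.cong) auto
  then show ?thesis by simp
qed

lemma ncps_const_commute: "f * ncps_const c = ncps_const c * f"
  by (rule ncps_eqI) (simp add: ncps_coeff_mult_const)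

lemma ncps_mult_const_left: "f * (ncps_const c * g) = ncps_const c * (f * g)"
  by (metis mult.assoc ncps_const_commute)

lemma ncps_const_mult_const_mult:
  "ncps_const c * f * (ncps_const d * g) = ncps_const (c * d) * (f * g)"
  by (rule ncps_eqI) (simp add: mult.assoc ncps_mult_const_left[of f])

lemma ncps_const_1 [simp]: "ncps_const 1 = 1"
  by (rule ncps_eqI) (simp add: ncps_const.rep_eq one_ncps.rep_eq)

lemma ncps_coeff_var_mult:
  "ncps_coeff (ncps_var i * f) w =
    (case w of [] \<Rightarrow> 0 | j # w' \<Rightarrow> if j = i then ncps_coeff f w' else 0)"
proof (cases w)
  case Nil
  then show ?thesis by (simp add: times_ncps.rep_eq ncps_var.rep_eq)
next
  case (Cons j w')
  \<comment> \<open>Only the cut of \<open>w\<close> just after its first letter can have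
    \<open>[i]\<close> as left part.\<close>
  have "ncps_coeff (ncps_var i * f) w =
      (\<Sum>k = 0..length w. if k = 1 then (if j = i then ncps_coeff f w' else 0) else 0)"
    unfolding times_ncps.rep_eq ncps_var.rep_eq
  proof (rule sum.cong)
    fix k assume "k \<in> {0..length w}"
    then show "(if take k w = [i] then 1 else 0) * ncps_coeff f (drop k w) =
        (if k = 1 then (if j = i then ncps_coeff f w' else 0) else 0)"
      using Cons by (cases k; cases "k - 1"; cases w') auto
  qed simp
  also have "\<dots> = (if j = i then ncps_coeff f w' else 0)"
    using Cons by (subst sum.delta) auto
  finally show ?thesis using Cons by simp
qed

definition ncps_mono :: "'n list \<Rightarrow> ('a::comm_ring_1, 'n) ncps"
  where "ncps_mono w = prod_list (map ncps_var w)"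

lemma ncps_mono_Nil [simp]: "ncps_mono [] = 1"
  and ncps_mono_Cons: "ncps_mono (i # w) = ncps_var i * ncps_mono w"
  and ncps_mono_append: "ncps_mono (w @ w') = ncps_mono w * ncps_mono w'"
  by (simp_all add: ncps_mono_def)

lemma ncps_coeff_mono [simp]: "ncps_coeff (ncps_mono w) v = (if v = w then 1 else 0)"
  by (induction w arbitrary: v)
    (auto simp: one_ncps.rep_eq ncps_mono_Cons ncps_coeff_var_mult split: list.splits)

text \<open>A lower bound on the order, phrased through vanishing coefficients so that the zero
  series, of infinite order, needs no separate treatment.\<close>

definition ord_ge :: "nat \<Rightarrow> ('a::comm_ring_1, 'n) ncps \<Rightarrow> bool"
  where "ord_ge m f \<longleftrightarrow> (\<forall>w. length w < m \<longrightarrow> ncps_coeff f w = 0)"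

lemma ncps_order_ge_iff: "enat m \<le> ncps_order f \<longleftrightarrow> ord_ge m f"
  unfolding ncps_order_def ord_ge_def le_INF_iff by (auto simp: not_less[symmetric])

lemma ncps_vec_order_ge_iff: "enat m \<le> ncps_vec_order U \<longleftrightarrow> (\<forall>i. ord_ge m (U $ i))"
  unfolding ncps_vec_order_def by (subst Min_ge_iff) (auto simp: ncps_order_ge_iff)

lemma ord_ge_0 [simp]: "ord_ge 0 f"
  by (simp add: ord_ge_def)

lemma ord_ge_zero [simp]: "ord_ge m 0"
  by (simp add: ord_ge_def)

lemma ord_ge_mono: "ord_ge m f \<Longrightarrow> k \<le> m \<Longrightarrow> ord_ge k f"
  by (simp add: ord_ge_def)

lemma ord_ge_add: "ord_ge m f \<Longrightarrow> ord_ge m g \<Longrightarrow> ord_ge m (f + g)"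
  and ord_ge_diff: "ord_ge m f \<Longrightarrow> ord_ge m g \<Longrightarrow> ord_ge m (f - g)"
  and ord_ge_uminus: "ord_ge m f \<Longrightarrow> ord_ge m (- f)"
  by (simp_all add: ord_ge_def)

lemma ord_ge_sum: "(\<And>x. x \<in> A \<Longrightarrow> ord_ge m (f x)) \<Longrightarrow> ord_ge m (sum f A)"
  by (simp add: ord_ge_def)

lemma ord_ge_mult:
  assumes "ord_ge m f" "ord_ge n g"
  shows "ord_ge (m + n) (f * g)"
  unfolding ord_ge_def times_ncps.rep_eq
proof (intro allI impI sum.neutral ballI)
  fix w :: "'b list" and i
  assume w: "length w < m + n" and i: "i \<in> {0..length w}"
  \<comment> \<open>As \<open>w\<close> is shorter than \<open>m + n\<close>, either its left part
    is shorter than \<open>m\<close> or its right part is shorter than \<open>n\<close>.\<close>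
  show "ncps_coeff f (take i w) * ncps_coeff g (drop i w) = 0"
    using assms w i by (cases "i < m") (auto simp: ord_ge_def)
qed

lemma ord_ge_mult_left: "ord_ge n g \<Longrightarrow> ord_ge n (f * g)"
  using ord_ge_mult[of 0 f n g] by simp

lemma ord_ge_mult_right: "ord_ge n f \<Longrightarrow> ord_ge n (f * g)"
  using ord_ge_mult[of n f 0 g] by simp

lemma ord_ge_var: "ord_ge 1 (ncps_var i)"
  by (simp add: ord_ge_def ncps_var.rep_eq)

lemma ord_ge_prod_list:
  assumes "\<And>i. ord_ge 1 (F i)"
  shows "ord_ge (length w) (prod_list (map F w))"
proof (induction w)
  case (Cons i w)
  then show ?case using ord_ge_mult[OF assms[of i] Cons] by simp
qed simp

lemma finite_words_le: "finite {w :: 'n::finite list. length w \<le> m}"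
  using finite_lists_length_le[of "UNIV :: 'n set" m] by simp

section \<open>Continuous additive maps\<close>

text \<open>The loss of order \<open>k\<close> is uniform in \<open>m\<close>, so that losses simply
  add up under composition. Only additivity is asked, not linearity, because d/dt is not linear over
  k[[t]].\<close>

definition ncps_cont :: "(('a::comm_ring_1, 'n) ncps \<Rightarrow> ('a, 'n) ncps) \<Rightarrow> bool"
  where "ncps_cont A \<longleftrightarrow> (\<forall>f g. A (f + g) = A f + A g) \<and>
    (\<exists>k. \<forall>m f. ord_ge (m + k) f \<longrightarrow> ord_ge m (A f))"

lemma ncps_contI:
  assumes "\<And>f g. A (f + g) = A f + A g" and "\<And>m f. ord_ge (m + k) f \<Longrightarrow> ord_ge m (A f)"
  shows "ncps_cont A"
  using assms unfolding ncps_cont_def by blast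

lemma ncps_cont_sum:
  assumes "ncps_cont A"
  shows "A (sum f S) = (\<Sum>x\<in>S. A (f x))"
proof -
  have add: "A (f + g) = A f + A g" for f g
    using assms by (simp add: ncps_cont_def)
  have "A 0 = 0" using add[of 0 0] by simp
  then show ?thesis by (induction S rule: infinite_finite_induct) (auto simp: add)
qed

text \<open>Density of polynomials: \<open>f\<close> is cut off to a finite sum \<open>p\<close> of
  terms, finite because there are finitely many variables, and the remainder has too high an order
  to influence the coefficient at \<open>v\<close>. Since the maps are merely additive, the terms
  must carry their scalars \<open>c\<close>.\<close>

lemma ncps_cont_eqI:
  fixes A B :: "('a::comm_ring_1, 'n::finite) ncps \<Rightarrow> ('a, 'n) ncps"
  assumes A: "ncps_cont A" and B: "ncps_cont B"
    and eq: "\<And>c w. A (ncps_const c * ncps_mono w) = B (ncps_const c * ncps_mono w)"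
  shows "A f = B f"
proof (rule ncps_eqI)
  fix v :: "'n list"
  obtain a where a: "\<And>m f. ord_ge (m + a) f \<Longrightarrow> ord_ge m (A f)"
    using A by (auto simp: ncps_cont_def)
  obtain b where b: "\<And>m f. ord_ge (m + b) f \<Longrightarrow> ord_ge m (B f)"
    using B by (auto simp: ncps_cont_def)
  \<comment> \<open>High enough that the images of the remainder under \<open>A\<close> and
    \<open>B\<close> both vanish in degree \<open>length v\<close>.\<close>
  define m where "m = Suc (length v) + a + b"
  define p where "p = (\<Sum>w | length w \<le> m. ncps_const (ncps_coeff f w) * ncps_mono w)"
  have "ncps_coeff p w = ncps_coeff f w" if "length w < m" for w
  proof -
    have "ncps_coeff p w = (\<Sum>w' | length w' \<le> m. if w' = w then ncps_coeff f w else 0)"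
      unfolding p_def ncps_coeff_sum by (rule sum.cong) auto
    then show ?thesis using that by (simp add: finite_words_le)
  qed
  then have r: "ord_ge m (f - p)" by (simp add: ord_ge_def)
  have "ord_ge (Suc (length v)) (A (f - p))"
    using a ord_ge_mono[OF r, of "Suc (length v) + a"] by (simp add: m_def)
  moreover have "ord_ge (Suc (length v)) (B (f - p))"
    using b ord_ge_mono[OF r, of "Suc (length v) + b"] by (simp add: m_def)
  moreover have "A f = A p + A (f - p)" "B f = B p + B (f - p)"
    using A B unfolding ncps_cont_def by (metis add.commute diff_add_cancel)+
  moreover have "A p = B p"
    unfolding p_def ncps_cont_sum[OF A] ncps_cont_sum[OF B] eq ..
  ultimately show "ncps_coeff (A f) v = ncps_coeff (B f) v"
    by (simp add: ord_ge_def)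
qed

lemma ncps_cont_ident: "ncps_cont (\<lambda>f. f)"
  by (rule ncps_contI[where k = 0]) auto

lemma ncps_cont_compose:
  assumes "ncps_cont A" "ncps_cont B"
  shows "ncps_cont (\<lambda>f. A (B f))"
proof -
  obtain a where a: "\<And>m f. ord_ge (m + a) f \<Longrightarrow> ord_ge m (A f)"
    using assms(1) by (auto simp: ncps_cont_def)
  obtain b where b: "\<And>m f. ord_ge (m + b) f \<Longrightarrow> ord_ge m (B f)"
    using assms(2) by (auto simp: ncps_cont_def)
  show ?thesis
  proof (rule ncps_contI[where k = "a + b"])
    show "A (B (f + g)) = A (B f) + A (B g)" for f g
      using assms by (simp add: ncps_cont_def)
    show "ord_ge m (A (B f))" if "ord_ge (m + (a + b)) f" for m f
      using a b that by (simp add: add.assoc)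
  qed
qed

lemma ncps_cont_add:
  assumes "ncps_cont A" "ncps_cont B"
  shows "ncps_cont (\<lambda>f. A f + B f)"
proof -
  obtain a where a: "\<And>m f. ord_ge (m + a) f \<Longrightarrow> ord_ge m (A f)"
    using assms(1) by (auto simp: ncps_cont_def)
  obtain b where b: "\<And>m f. ord_ge (m + b) f \<Longrightarrow> ord_ge m (B f)"
    using assms(2) by (auto simp: ncps_cont_def)
  show ?thesis
  proof (rule ncps_contI[where k = "a + b"])
    show "A (f + g) + B (f + g) = A f + B f + (A g + B g)" for f g
      using assms by (simp add: ncps_cont_def algebra_simps)
    show "ord_ge m (A f + B f)" if "ord_ge (m + (a + b)) f" for m f
      by (intro ord_ge_add a b; rule ord_ge_mono[OF that]) auto
  qed
qed

lemma ncps_cont_mult_left: "ncps_cont A \<Longrightarrow> ncps_cont (\<lambda>f. g * A f)"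
  by (rule ncps_cont_compose[of "\<lambda>f. g * f" A])
    (auto intro!: ncps_contI[where k = 0] simp: distrib_left ord_ge_mult_left)

lemma ncps_cont_mult_right: "ncps_cont A \<Longrightarrow> ncps_cont (\<lambda>f. A f * g)"
  by (rule ncps_cont_compose[of "\<lambda>f. f * g" A])
    (auto intro!: ncps_contI[where k = 0] simp: distrib_right ord_ge_mult_right)

lemmas ncps_cont_intros =
  ncps_cont_ident ncps_cont_add ncps_cont_mult_left ncps_cont_mult_right

text \<open>Density in one argument after the other; this form serves multiplicativity of
  substitution and the Leibniz rule.\<close>

lemma ncps_cont_eqI2:
  fixes A B :: "('a::comm_ring_1, 'n::finite) ncps \<Rightarrow> ('a, 'n) ncps \<Rightarrow> ('a, 'n) ncps"
  assumes "\<And>g. ncps_cont (\<lambda>f. A f g)" "\<And>f. ncps_cont (A f)"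
    and "\<And>g. ncps_cont (\<lambda>f. B f g)" "\<And>f. ncps_cont (B f)"
    and eq: "\<And>c w d w'. A (ncps_const c * ncps_mono w) (ncps_const d * ncps_mono w') =
      B (ncps_const c * ncps_mono w) (ncps_const d * ncps_mono w')"
  shows "A f g = B f g"
proof (rule ncps_cont_eqI[of "\<lambda>f. A f g" "\<lambda>f. B f g"])
  fix c and w :: "'n list"
  show "A (ncps_const c * ncps_mono w) g = B (ncps_const c * ncps_mono w) g"
    by (rule ncps_cont_eqI[of "A (ncps_const c * ncps_mono w)"]) (fact assms)+
qed (fact assms)+

text \<open>The continuous linear extension of a map on words that lowers the order by at most \<open>k\<close>;
  \<open>k = 0\<close> is substitution and \<open>k = 1\<close> a derivation.\<close>

definition ncps_ext ::
    "nat \<Rightarrow> ('n::finite list \<Rightarrow> ('a::comm_ring_1, 'n) ncps) \<Rightarrow> ('a, 'n) ncps \<Rightarrow> ('a, 'n) ncps"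
  where "ncps_ext k P f =
    Abs_ncps (\<lambda>v. \<Sum>w | length w \<le> length v + k. ncps_coeff f w * ncps_coeff (P w) v)"

lemma ncps_coeff_ext:
  "ncps_coeff (ncps_ext k P f) v =
    (\<Sum>w | length w \<le> length v + k. ncps_coeff f w * ncps_coeff (P w) v)"
  by (simp add: ncps_ext_def Abs_ncps_inverse)

lemma ord_ge_ext:
  assumes "ord_ge (m + k) f"
  shows "ord_ge m (ncps_ext k P f)"
  using assms unfolding ord_ge_def ncps_coeff_ext by (intro allI impI sum.neutral) auto

lemma ncps_cont_ext: "ncps_cont (ncps_ext k P)"
  by (rule ncps_contI[where k = k])
    (auto intro!: ncps_eqI ord_ge_ext simp: ncps_coeff_ext sum.distrib distrib_right)

lemma ncps_ext_const_mult: "ncps_ext k P (ncps_const c * f) = ncps_const c * ncps_ext k P f"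
  by (rule ncps_eqI) (simp add: ncps_coeff_ext sum_distrib_left mult.assoc)

text \<open>The finite sum defining the coefficient at \<open>v\<close> leaves out \<open>w\<close>
  only if \<open>length v < length w - k\<close>, and there \<open>P w\<close> has coefficient 0 by
  the order hypothesis.\<close>

lemma ncps_ext_mono:
  assumes "ord_ge (length w - k) (P w)"
  shows "ncps_ext k P (ncps_mono w) = P w"
proof (rule ncps_eqI)
  fix v
  have "ncps_coeff (ncps_ext k P (ncps_mono w)) v =
      (\<Sum>w' | length w' \<le> length v + k. if w' = w then ncps_coeff (P w) v else 0)"
    unfolding ncps_coeff_ext by (rule sum.cong) auto
  also have "\<dots> = ncps_coeff (P w) v"
    using assms by (auto simp: finite_words_le ord_ge_def)
  finally show "ncps_coeff (ncps_ext k P (ncps_mono w)) v = ncps_coeff (P w) v" .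
qed

lemma mono_mult_mono:
  "ncps_const c * ncps_mono w * (ncps_const d * ncps_mono w') =
    ncps_const (c * d) * ncps_mono (w @ w')"
  by (simp add: ncps_const_mult_const_mult ncps_mono_append)

section \<open>Substitution\<close>

lemma ncps_subst_eq_ext: "ncps_subst u F = ncps_ext 0 (\<lambda>w. prod_list (map (($) F) w)) u"
  by (simp add: ncps_subst_def ncps_ext_def)

lemma ncps_cont_subst: "ncps_cont (\<lambda>u. ncps_subst u F)"
  unfolding ncps_subst_eq_ext by (rule ncps_cont_ext)

lemma ncps_subst_const_mult: "ncps_subst (ncps_const c * u) F = ncps_const c * ncps_subst u F"
  unfolding ncps_subst_eq_ext by (rule ncps_ext_const_mult)

lemma ord_ge_subst: "ord_ge m u \<Longrightarrow> ord_ge m (ncps_subst u F)"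
  unfolding ncps_subst_eq_ext by (rule ord_ge_ext) simp

lemma ncps_subst_add: "ncps_subst (u + v) F = ncps_subst u F + ncps_subst v F"
  using ncps_cont_subst[of F] by (simp add: ncps_cont_def)

lemma ncps_subst_diff: "ncps_subst (u - v) F = ncps_subst u F - ncps_subst v F"
  by (metis add_diff_cancel diff_add_cancel ncps_subst_add)

lemma ncps_subst_mono:
  assumes "\<And>i. ord_ge 1 (F $ i)"
  shows "ncps_subst (ncps_mono w) F = prod_list (map (($) F) w)"
  unfolding ncps_subst_eq_ext
  by (rule ncps_ext_mono) (use ord_ge_prod_list[of "($) F", OF assms] in simp)

lemma ncps_subst_var:
  assumes "\<And>i. ord_ge 1 (F $ i)"
  shows "ncps_subst (ncps_var i) F = F $ i"
  using ncps_subst_mono[OF assms, of "[i]"] by (simp add: ncps_mono_Cons)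

lemma ncps_subst_const:
  assumes "\<And>i. ord_ge 1 (F $ i)"
  shows "ncps_subst (ncps_const c) F = ncps_const c"
  using ncps_subst_mono[OF assms, of "[]"] ncps_subst_const_mult[of c 1 F] by simp

lemma ncps_subst_mult:
  assumes "\<And>i. ord_ge 1 (F $ i)"
  shows "ncps_subst (u * v) F = ncps_subst u F * ncps_subst v F"
proof (rule ncps_cont_eqI2[of "\<lambda>u v. ncps_subst (u * v) F"
      "\<lambda>u v. ncps_subst u F * ncps_subst v F"])
  show "ncps_subst (ncps_const c * ncps_mono w * (ncps_const d * ncps_mono w')) F =
      ncps_subst (ncps_const c * ncps_mono w) F * ncps_subst (ncps_const d * ncps_mono w') F"
    for c w d w'
    unfolding mono_mult_mono
    by (simp add: ncps_subst_const_mult ncps_subst_mono[OF assms] ncps_const_mult_const_mult)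
qed (intro ncps_cont_intros ncps_cont_subst ncps_cont_compose[OF ncps_cont_subst])+

lemma ncps_subst_prod_list:
  assumes "\<And>i. ord_ge 1 (F $ i)"
  shows "ncps_subst (prod_list us) F = prod_list (map (\<lambda>u. ncps_subst u F) us)"
proof (induction us)
  case Nil
  then show ?case using ncps_subst_mono[OF assms, of "[]"] by simp
qed (simp add: ncps_subst_mult[OF assms])

lemma ncps_vec_subst_nth [simp]: "ncps_vec_subst U F $ i = ncps_subst (U $ i) F"
  by (simp add: ncps_vec_subst_def)

lemma ncps_vars_nth [simp]: "ncps_vars $ i = ncps_var i"
  by (simp add: ncps_vars_def)

text \<open>Substituting \<open>G\<close> is multiplicative, so on a word both sides are the product
  of the series F_i(G) along its letters; density does the rest.\<close>

lemma ncps_subst_subst: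
  assumes "\<And>i. ord_ge 1 (F $ i)" "\<And>i. ord_ge 1 (G $ i)"
  shows "ncps_subst (ncps_subst u F) G = ncps_subst u (ncps_vec_subst F G)"
proof (rule ncps_cont_eqI[of "\<lambda>u. ncps_subst (ncps_subst u F) G"])
  have FG1: "ord_ge 1 (ncps_vec_subst F G $ i)" for i
    using assms by (simp add: ord_ge_subst)
  have eta: "($) (ncps_vec_subst F G) = (\<lambda>i. ncps_subst (F $ i) G)"
    by auto
  show "ncps_subst (ncps_subst (ncps_const c * ncps_mono w) F) G =
      ncps_subst (ncps_const c * ncps_mono w) (ncps_vec_subst F G)" for c w
    by (simp add: ncps_subst_const_mult ncps_subst_mono[OF assms(1)] ncps_subst_mono[OF FG1]
        ncps_subst_prod_list[OF assms(2)] o_def eta)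
qed (intro ncps_cont_subst ncps_cont_compose[OF ncps_cont_subst])+

lemma ncps_subst_vars [simp]:
  fixes u :: "('a::comm_ring_1, 'n::finite) ncps"
  shows "ncps_subst u ncps_vars = u"
proof (rule ncps_cont_eqI[of "\<lambda>u. ncps_subst u ncps_vars"])
  have vars1: "ord_ge 1 ((ncps_vars :: ('a, 'n) ncps ^ 'n) $ i)" for i
    by (simp add: ord_ge_var[unfolded One_nat_def])
  have eta: "($) (ncps_vars :: ('a, 'n) ncps ^ 'n) = ncps_var"
    by auto
  show "ncps_subst (ncps_const c * ncps_mono w) ncps_vars = ncps_const c * ncps_mono w"
    for c :: 'a and w :: "'n list"
    unfolding ncps_subst_const_mult ncps_subst_mono[OF vars1] eta by (simp add: ncps_mono_def)
qed (intro ncps_cont_intros ncps_cont_subst)+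

lemma ncps_vec_subst_vars [simp]: "ncps_vec_subst U ncps_vars = U"
  by (simp add: vec_eq_iff)

lemma ncps_vec_subst_vars_left:
  assumes "\<And>i. ord_ge 1 (F $ i)"
  shows "ncps_vec_subst ncps_vars F = F"
  using assms by (simp add: vec_eq_iff ncps_subst_var)

lemma ncps_vec_subst_subst:
  assumes "\<And>i. ord_ge 1 (F $ i)" "\<And>i. ord_ge 1 (G $ i)"
  shows "ncps_vec_subst (ncps_vec_subst U F) G = ncps_vec_subst U (ncps_vec_subst F G)"
  using assms by (simp add: vec_eq_iff ncps_subst_subst)

lemma ncps_vec_subst_diff:
  "ncps_vec_subst (U - V) F = ncps_vec_subst U F - ncps_vec_subst V F"
  by (simp add: vec_eq_iff ncps_subst_diff)

section \<open>The inverse map\<close>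

text \<open>Telescoping: replacing one factor costs a difference of order at least \<open>m\<close>,
  while each of the \<open>length w\<close> other factors contributes order at least 1.\<close>

lemma ord_ge_prod_list_diff:
  assumes "\<And>i. ord_ge 1 (A i)" "\<And>i. ord_ge 1 (B i)" "\<And>i. ord_ge m (A i - B i)"
  shows "ord_ge (m + length w) (prod_list (map A (i # w)) - prod_list (map B (i # w)))"
proof (induction w arbitrary: i)
  case Nil
  then show ?case using assms by simp
next
  case (Cons j w)
  let ?a = "prod_list (map A (j # w))" and ?b = "prod_list (map B (j # w))"
  have "ord_ge (m + length (j # w)) ((A i - B i) * ?a)"
    by (intro ord_ge_mult ord_ge_prod_list assms)
  moreover have "ord_ge (1 + (m + length w)) (B i * (?a - ?b))"
    by (intro ord_ge_mult assms Cons)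
  moreover have "A i * ?a - B i * ?b = (A i - B i) * ?a + B i * (?a - ?b)"
    by (simp add: algebra_simps)
  ultimately show ?case
    by (simp add: ord_ge_add)
qed

text \<open>The contraction estimate: \<open>h\<close> involves only words of length at least 2, so
  every product has a further factor besides the one being changed, which gains one degree.\<close>

lemma ord_ge_subst_diff:
  assumes "ord_ge 2 h"
    and "\<And>i. ord_ge 1 (A $ i)" "\<And>i. ord_ge 1 (B $ i)" "\<And>i. ord_ge m (A $ i - B $ i)"
  shows "ord_ge (Suc m) (ncps_subst h A - ncps_subst h B)"
  unfolding ord_ge_def
proof (intro allI impI)
  fix v :: "'b list" assume v: "length v < Suc m"
  have "ncps_coeff h w * ncps_coeff (prod_list (map (($) A) w)) v =
      ncps_coeff h w * ncps_coeff (prod_list (map (($) B) w)) v" for w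
  proof (cases "length w < 2")
    case True
    then show ?thesis using assms(1) by (simp add: ord_ge_def)
  next
    case False
    then obtain i j w' where w: "w = i # j # w'"
      by (metis One_nat_def Suc_1 length_Cons lessI list.exhaust list.size(3) zero_less_numeral)
    have "ord_ge (m + length (j # w')) (prod_list (map (($) A) w) - prod_list (map (($) B) w))"
      unfolding w by (rule ord_ge_prod_list_diff) (use assms in auto)
    then have "ord_ge (Suc m) (prod_list (map (($) A) w) - prod_list (map (($) B) w))"
      by (rule ord_ge_mono) simp
    then show ?thesis using v by (simp add: ord_ge_def)
  qed
  then show "ncps_coeff (ncps_subst h A - ncps_subst h B) v = 0"
    by (simp add: ncps_subst_eq_ext ncps_coeff_ext)
qed

text \<open>The fixed point equation says that (z - H)(G) = z. The solution is the limit of the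
  iterates \<open>X k\<close> started at z.\<close>

lemma right_inverse_exists:
  fixes H :: "('a::comm_ring_1, 'n::finite) ncps ^ 'n"
  assumes H: "\<And>i. ord_ge 2 (H $ i)"
  obtains G where "\<And>i. ord_ge 1 (G $ i)" "G = ncps_vars + ncps_vec_subst H G"
proof -
  define X where "X k = ((\<lambda>G. ncps_vars + ncps_vec_subst H G) ^^ k) ncps_vars" for k
  have X_Suc: "X (Suc k) = ncps_vars + ncps_vec_subst H (X k)" for k
    by (simp add: X_def)
  have H1: "ord_ge 1 (ncps_subst (H $ i) Y)" for i Y
    by (rule ord_ge_subst) (rule ord_ge_mono[OF H], simp)
  have X1: "ord_ge 1 (X k $ i)" for k i
    using ord_ge_add[OF ord_ge_var H1] ord_ge_var
    by (cases k) (simp_all add: X_Suc, simp add: X_def)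
  \<comment> \<open>Consecutive iterates agree up to degree \<open>k\<close>: initially because both
    have no constant term, then one degree more at each step by the contraction estimate.\<close>
  have step: "ord_ge (Suc k) (X (Suc k) $ i - X k $ i)" for k i
  proof (induction k arbitrary: i)
    case 0
    then show ?case using X1[of 1 i] X1[of 0 i] by (simp add: ord_ge_diff)
  next
    case (Suc k)
    show ?case
      using ord_ge_subst_diff[OF H X1 X1 Suc] by (simp add: X_Suc)
  qed
  have lim: "ord_ge (Suc k) (X (k + d) $ i - X k $ i)" for k d i
  proof (induction d)
    case (Suc d)
    have "ord_ge (Suc k) (X (Suc (k + d)) $ i - X (k + d) $ i)"
      by (rule ord_ge_mono[OF step]) simp
    from ord_ge_add[OF this Suc] show ?case by simp
  qed simp
  \<comment> \<open>The coefficient at \<open>v\<close> no longer changes from the iterate with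
    index \<open>length v\<close> on, so this diagonal choice is the limit.\<close>
  define G :: "('a, 'n) ncps ^ 'n"
    where "G = (\<chi> i. Abs_ncps (\<lambda>v. ncps_coeff (X (length v) $ i) v))"
  have coeff_G: "ncps_coeff (G $ i) v = ncps_coeff (X (length v) $ i) v" for i v
    by (simp add: G_def Abs_ncps_inverse)
  have GX: "ord_ge (Suc k) (G $ i - X k $ i)" for k i
    unfolding ord_ge_def
  proof (intro allI impI)
    fix v :: "'n list" assume "length v < Suc k"
    then obtain d where "k = length v + d"
      using less_Suc_eq_le le_Suc_ex by blast
    then show "ncps_coeff (G $ i - X k $ i) v = 0"
      using lim[of "length v" d i] by (simp add: coeff_G ord_ge_def)
  qed
  have G1: "ord_ge 1 (G $ i)" for i
    using ord_ge_add[OF ord_ge_mono[OF GX[of 0 i], of 1] X1[of 0 i]] by simp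
  \<comment> \<open>In degree \<open>length v\<close>, \<open>G\<close> agrees with the next iterate
    z + H(X), where \<open>X\<close> is the iterate with index \<open>length v\<close>, and H(X)
    agrees there with H(G).\<close>
  have "G $ i = (ncps_vars + ncps_vec_subst H G) $ i" for i
  proof (rule ncps_eqI)
    fix v :: "'n list"
    let ?k = "length v"
    have "ord_ge (Suc ?k) (G $ i - X (Suc ?k) $ i)"
      by (rule ord_ge_mono[OF GX]) simp
    moreover have "ord_ge (Suc ?k) (ncps_subst (H $ i) (X ?k) - ncps_subst (H $ i) G)"
    proof (rule ord_ge_mono[OF ord_ge_subst_diff[OF H X1 G1, of "Suc ?k"]])
      show "ord_ge (Suc ?k) (X ?k $ j - G $ j)" for j
        using ord_ge_uminus[OF GX[of ?k j]] by simp
    qed simp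
    ultimately show "ncps_coeff (G $ i) v = ncps_coeff ((ncps_vars + ncps_vec_subst H G) $ i) v"
      by (simp add: ord_ge_def X_Suc algebra_simps)
  qed
  then have "G = ncps_vars + ncps_vec_subst H G"
    by (simp add: vec_eq_iff)
  with G1 show thesis by (rule that)
qed

text \<open>The right inverse \<open>G\<close> is again of the form \<open>z - H'\<close> with \<open>H'\<close> of order at least 2, so it has
  a right inverse itself, which must be \<open>F\<close>.\<close>

lemma is_inverse_map_exists:
  fixes H :: "('a::comm_ring_1, 'n::finite) ncps ^ 'n"
  assumes H: "\<And>i. ord_ge 2 (H $ i)"
  shows "\<exists>G. is_inverse_map (ncps_vars - H) G"
proof -
  let ?F = "ncps_vars - H"
  obtain G where G1: "\<And>i. ord_ge 1 (G $ i)" and G: "G = ncps_vars + ncps_vec_subst H G"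
    using right_inverse_exists[OF H] by blast
  let ?H' = "- ncps_vec_subst H G"
  have "ord_ge 2 (?H' $ i)" for i
    by (simp add: ord_ge_subst ord_ge_uminus H)
  then obtain F' where F'1: "\<And>i. ord_ge 1 (F' $ i)" and F': "F' = ncps_vars + ncps_vec_subst ?H' F'"
    using right_inverse_exists by blast
  have F1: "ord_ge 1 (?F $ i)" for i
    by (simp add: ord_ge_diff ord_ge_var[unfolded One_nat_def] ord_ge_mono[OF H])
  have FG: "ncps_vec_subst ?F G = ncps_vars"
    using G by (simp add: ncps_vec_subst_diff ncps_vec_subst_vars_left[OF G1] algebra_simps)
  have "G = ncps_vars - ?H'"
    using G by simp
  then have "ncps_vec_subst G F' = ncps_vec_subst (ncps_vars - ?H') F'"
    by (rule arg_cong)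
  also have "\<dots> = ncps_vars"
    unfolding ncps_vec_subst_diff ncps_vec_subst_vars_left[OF F'1]
    using F' by (simp add: algebra_simps)
  finally have GF': "ncps_vec_subst G F' = ncps_vars" .
  \<comment> \<open>By associativity F = F(G(F')) = (F(G))(F') = F', so the left and right inverses
    of \<open>G\<close> coincide.\<close>
  have "?F = ncps_vec_subst ?F (ncps_vec_subst G F')"
    by (simp add: GF')
  also have "\<dots> = F'"
    by (simp add: FG ncps_vec_subst_vars_left[OF F'1] flip: ncps_vec_subst_subst[OF G1 F'1])
  finally have "?F = F'" .
  then have "is_inverse_map ?F G"
    using G1 FG GF' ncps_vec_order_ge_iff[of 1 G] by (simp add: is_inverse_map_def one_enat_def)
  then show ?thesis by blast
qed

text \<open>The usual argument G = (G'(F))(G) = G'(F(G)) = G'. The order condition in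
  \<open>is_inverse_map\<close> makes associativity applicable.\<close>

lemma is_inverse_map_unique:
  assumes F1: "\<And>i. ord_ge 1 (F $ i)" and "is_inverse_map F G" "is_inverse_map F G'"
  shows "G = G'"
proof -
  have G1: "ord_ge 1 (G $ i)" and G'1: "ord_ge 1 (G' $ i)" for i
    using assms(2,3) ncps_vec_order_ge_iff[of 1 G] ncps_vec_order_ge_iff[of 1 G']
    by (simp_all add: is_inverse_map_def one_enat_def)
  have "G = ncps_vec_subst (ncps_vec_subst G' F) G"
    using assms(3) by (simp add: is_inverse_map_def ncps_vec_subst_vars_left[OF G1])
  also have "\<dots> = G'"
    using assms(2) by (simp add: ncps_vec_subst_subst[OF F1 G1] is_inverse_map_def)
  finally show ?thesis .
qed

lemma is_inverse_map_inverse_map: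
  assumes "\<And>i. ord_ge 2 (H $ i)"
  shows "is_inverse_map (ncps_vars - H) (inverse_map (ncps_vars - H))"
proof -
  have "ord_ge 1 ((ncps_vars - H) $ i)" for i
    by (simp add: ord_ge_diff ord_ge_var[unfolded One_nat_def] ord_ge_mono[OF assms])
  then have "\<exists>!G. is_inverse_map (ncps_vars - H) G"
    using is_inverse_map_exists[OF assms] is_inverse_map_unique by blast
  then show ?thesis
    unfolding inverse_map_def by (rule theI')
qed

section \<open>Derivations\<close>

text \<open>The value on a word that the Leibniz rule forces: the sum, over all positions, of the
  word with the letter \<open>i\<close> there replaced by \<open>u $ i\<close>.\<close>

fun word_deriv :: "('a::comm_ring_1, 'n) ncps ^ 'n \<Rightarrow> 'n list \<Rightarrow> ('a, 'n) ncps"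
  where
    "word_deriv u [] = 0"
  | "word_deriv u (i # w) = u $ i * ncps_mono w + ncps_var i * word_deriv u w"

lemma word_deriv_append:
  "word_deriv u (w @ w') = word_deriv u w * ncps_mono w' + ncps_mono w * word_deriv u w'"
  by (induction w) (simp_all add: ncps_mono_append ncps_mono_Cons algebra_simps)

text \<open>One letter gives way to a series that may have order 0, so one degree is lost; this is
  the bound that \<open>ncps_ext_mono\<close> requires for \<open>k = 1\<close>.\<close>

lemma ord_ge_word_deriv: "ord_ge (length w - 1) (word_deriv u w)"
proof (induction w)
  case (Cons i w)
  have "ord_ge (length w) (u $ i * ncps_mono w)"
    by (rule ord_ge_mult_left) (simp add: ord_ge_def)
  moreover have "ord_ge (length w) (ncps_var i * word_deriv u w)"
    by (rule ord_ge_mono[OF ord_ge_mult[OF ord_ge_var Cons]]) simp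
  ultimately show ?case by (simp add: ord_ge_add)
qed simp

text \<open>The continuous extension of \<open>word_deriv\<close> works: by density its Leibniz rule
  reduces to concatenated words, where it is \<open>word_deriv_append\<close>.\<close>

lemma ncps_derivation_exists:
  fixes u :: "('a::comm_ring_1, 'n::finite) ncps ^ 'n"
  shows "\<exists>D. ncps_is_derivation D \<and> (\<forall>i. D (ncps_var i) = u $ i)"
proof -
  define D where "D = ncps_ext 1 (word_deriv u)"
  have cont: "ncps_cont D"
    unfolding D_def by (rule ncps_cont_ext)
  have const: "D (ncps_const c * f) = ncps_const c * D f" for c f
    unfolding D_def by (rule ncps_ext_const_mult)
  have mono: "D (ncps_mono w) = word_deriv u w" for w
    unfolding D_def by (rule ncps_ext_mono) (rule ord_ge_word_deriv)
  have "D (f * g) = D f * g + f * D g" for f g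
  proof (rule ncps_cont_eqI2[of "\<lambda>f g. D (f * g)" "\<lambda>f g. D f * g + f * D g"])
    show "D (ncps_const c * ncps_mono w * (ncps_const d * ncps_mono w')) =
        D (ncps_const c * ncps_mono w) * (ncps_const d * ncps_mono w') +
        ncps_const c * ncps_mono w * D (ncps_const d * ncps_mono w')" for c w d w'
      unfolding mono_mult_mono
      by (simp add: const mono word_deriv_append ncps_const_mult_const_mult distrib_left)
  qed (intro ncps_cont_intros cont ncps_cont_compose[OF cont])+
  then have "ncps_is_derivation D"
    using cont const by (simp add: ncps_is_derivation_def ncps_cont_def)
  moreover have "D (ncps_var i) = u $ i" for i
    using mono[of "[i]"] by (simp add: ncps_mono_Cons)
  ultimately show ?thesis by blast
qed

lemma ncps_derivation_1:
  assumes "ncps_is_derivation D"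
  shows "D 1 = 0"
proof -
  have "D (1 * 1) = D 1 * 1 + 1 * D 1"
    using assms unfolding ncps_is_derivation_def by blast
  then show ?thesis by simp
qed

lemma ncps_derivation_const:
  assumes "ncps_is_derivation D"
  shows "D (ncps_const c) = 0"
proof -
  have "D (ncps_const c * 1) = ncps_const c * D 1"
    using assms unfolding ncps_is_derivation_def by blast
  then show ?thesis by (simp add: ncps_derivation_1[OF assms])
qed

text \<open>A series of order at least \<open>m + 1\<close> is \<open>\<Sum>i. z\<^sub>i g\<^sub>i\<close> with \<open>g\<^sub>i\<close> of order at least
  \<open>m\<close>; finiteness of the set of variables is essential here.\<close>

lemma ncps_cont_derivation:
  fixes D :: "('a::comm_ring_1, 'n::finite) ncps \<Rightarrow> ('a, 'n) ncps"
  assumes D: "ncps_is_derivation D"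
  shows "ncps_cont D"
proof (rule ncps_contI[where k = 1])
  show add: "D (f + g) = D f + D g" for f g
    using D by (simp add: ncps_is_derivation_def)
  have "D 0 = 0" using add[of 0 0] by simp
  then have sum: "D (sum h S) = (\<Sum>x\<in>S. D (h x))" for h and S :: "'n set"
    by (induction S rule: infinite_finite_induct) (auto simp: add)
  show "ord_ge m (D f)" if "ord_ge (m + 1) f" for m f
    using that
  proof (induction m arbitrary: f)
    case (Suc m)
    \<comment> \<open>The words of \<open>f\<close> are sorted by their first letter; the empty word
      does not occur because \<open>f\<close> has positive order.\<close>
    define g where "g i = Abs_ncps (\<lambda>w. ncps_coeff f (i # w))" for i
    have coeff_g: "ncps_coeff (g i) w = ncps_coeff f (i # w)" for i w
      by (simp add: g_def Abs_ncps_inverse)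
    have g: "ord_ge (Suc m) (g i)" for i
      using Suc.prems by (simp add: ord_ge_def coeff_g)
    have "f = (\<Sum>i\<in>UNIV. ncps_var i * g i)"
    proof (rule ncps_eqI)
      show "ncps_coeff f w = ncps_coeff (\<Sum>i\<in>UNIV. ncps_var i * g i) w" for w
        using Suc.prems by (cases w) (simp_all add: ncps_coeff_var_mult coeff_g ord_ge_def)
    qed
    then have "D f = (\<Sum>i\<in>UNIV. D (ncps_var i) * g i + ncps_var i * D (g i))"
      using D by (simp add: sum ncps_is_derivation_def)
    \<comment> \<open>In the first summand \<open>g i\<close> already has the required order; in the
      second the induction hypothesis gives one degree less, which the factor z_i restores.\<close>
    moreover have "ord_ge (Suc m) (D (ncps_var i) * g i)" for i
      by (rule ord_ge_mult_left[OF g])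
    moreover have "ord_ge (Suc m) (ncps_var i * D (g i))" for i
      using ord_ge_mult[OF ord_ge_var Suc.IH, of "g i" i] g by simp
    ultimately show ?case
      by (simp add: ord_ge_sum ord_ge_add)
  qed simp
qed

text \<open>Agreement on words follows from the Leibniz rule. Continuity is not part of
  \<open>ncps_is_derivation\<close>, but it is automatic by \<open>ncps_cont_derivation\<close>, so
  density applies.\<close>

lemma ncps_derivation_unique:
  fixes D E :: "('a::comm_ring_1, 'n::finite) ncps \<Rightarrow> ('a, 'n) ncps"
  assumes D: "ncps_is_derivation D" and E: "ncps_is_derivation E"
    and eq: "\<And>i. D (ncps_var i) = E (ncps_var i)"
  shows "D = E"
proof
  fix f
  have "D (ncps_mono w) = E (ncps_mono w)" for w
  proof (induction w)
    case Nil
    then show ?case using D E by (simp add: ncps_derivation_1)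
  next
    case (Cons i w)
    then show ?case using D E by (simp add: ncps_mono_Cons ncps_is_derivation_def eq)
  qed
  then have "D (ncps_const c * ncps_mono w) = E (ncps_const c * ncps_mono w)" for c w
    using D E by (metis ncps_is_derivation_def)
  then show "D f = E f"
    by (rule ncps_cont_eqI[OF ncps_cont_derivation[OF D] ncps_cont_derivation[OF E]])
qed

text \<open>Existence and uniqueness together justify the definite description in
  \<open>ncps_derivation\<close>.\<close>

lemma ncps_derivation_props:
  "ncps_is_derivation (ncps_derivation u) \<and> (\<forall>i. ncps_derivation u (ncps_var i) = u $ i)"
proof -
  have "\<exists>!D. ncps_is_derivation D \<and> (\<forall>i. D (ncps_var i) = u $ i)"
    using ncps_derivation_exists[of u] ncps_derivation_unique by (metis (no_types, lifting))
  then show ?thesis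
    unfolding ncps_derivation_def by (rule theI')
qed

section \<open>The derivative with respect to the parameter\<close>

declare ncps_deriv_t.rep_eq [simp]

lemma ncps_cont_deriv_t: "ncps_cont ncps_deriv_t"
  by (rule ncps_contI[where k = 0]) (auto intro!: ncps_eqI simp: ord_ge_def)

lemma ncps_deriv_t_const: "ncps_deriv_t (ncps_const c) = ncps_const (fps_deriv c)"
  by (rule ncps_eqI) (simp add: ncps_const.rep_eq)

lemma ncps_deriv_t_var: "ncps_deriv_t (ncps_var i) = 0"
  by (rule ncps_eqI) (simp add: ncps_var.rep_eq)

lemma ncps_deriv_t_mult: "ncps_deriv_t (f * g) = ncps_deriv_t f * g + f * ncps_deriv_t g"
  by (rule ncps_eqI) (simp add: times_ncps.rep_eq fps_deriv_sum sum.distrib add.commute)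

lemma ncps_deriv_t_diff: "ncps_deriv_t (f - g) = ncps_deriv_t f - ncps_deriv_t g"
  by (rule ncps_eqI) simp

lemma ncps_vec_deriv_t_nth [simp]: "ncps_vec_deriv_t U $ i = ncps_deriv_t (U $ i)"
  by (simp add: ncps_vec_deriv_t_def)

lemma ncps_vec_deriv_t_diff:
  "ncps_vec_deriv_t (U - V) = ncps_vec_deriv_t U - ncps_vec_deriv_t V"
  by (simp add: vec_eq_iff ncps_deriv_t_diff)

lemma ncps_vec_deriv_t_vars [simp]: "ncps_vec_deriv_t ncps_vars = 0"
  by (simp add: vec_eq_iff ncps_deriv_t_var)

text \<open>Both sides are derivations along the homomorphism \<open>f \<mapsto> f(G)\<close>, so that only scalars and
  variables need to be compared.\<close>

lemma ncps_deriv_t_subst: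
  fixes f :: "('k::idom fps, 'n::finite) ncps"
  assumes G1: "\<And>i. ord_ge 1 (G $ i)" and u: "ncps_vec_subst u G = ncps_vec_deriv_t G"
  shows "ncps_deriv_t (ncps_subst f G) =
    ncps_subst (ncps_deriv_t f) G + ncps_subst (ncps_derivation u f) G"
proof -
  define D where "D = ncps_derivation u"
  have D: "ncps_is_derivation D" and D_var: "D (ncps_var i) = u $ i" for i
    using ncps_derivation_props[of u] by (simp_all add: D_def)
  have u': "ncps_subst (u $ i) G = ncps_deriv_t (G $ i)" for i
    using u by (simp add: vec_eq_iff)
  define L where "L f = ncps_deriv_t (ncps_subst f G)" for f
  define R where "R f = ncps_subst (ncps_deriv_t f) G + ncps_subst (D f) G" for f
  have L_mult: "L (f * g) = L f * ncps_subst g G + ncps_subst f G * L g" for f g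
    by (simp add: L_def ncps_subst_mult[OF G1] ncps_deriv_t_mult)
  have R_mult: "R (f * g) = R f * ncps_subst g G + ncps_subst f G * R g" for f g
    using D by (simp add: R_def ncps_is_derivation_def ncps_subst_mult[OF G1] ncps_subst_add
        ncps_deriv_t_mult algebra_simps)
  have zero: "ncps_subst 0 G = 0"
    using ncps_subst_diff[of 0 0 G] by simp
  \<comment> \<open>On scalars \<open>D\<close> vanishes and only d/dt contributes. On variables it
    is the reverse: d/dt vanishes, and u_i(G) is the t-derivative of G_i by hypothesis.\<close>
  have const: "L (ncps_const c) = R (ncps_const c)" for c
    using D by (simp add: L_def R_def ncps_subst_const[OF G1] ncps_deriv_t_const
        ncps_derivation_const zero)
  have var: "L (ncps_var i) = R (ncps_var i)" for i
    by (simp add: L_def R_def ncps_subst_var[OF G1] ncps_deriv_t_var zero D_var u')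
  have mono: "L (ncps_mono w) = R (ncps_mono w)" for w
  proof (induction w)
    case Nil
    then show ?case using const[of 1] by simp
  next
    case (Cons i w)
    then show ?case by (simp add: ncps_mono_Cons L_mult R_mult var)
  qed
  have "L f = R f"
  proof (rule ncps_cont_eqI[of L R])
    show "ncps_cont L"
      unfolding L_def by (intro ncps_cont_compose[OF ncps_cont_deriv_t] ncps_cont_subst)
    show "ncps_cont R"
      unfolding R_def
      by (intro ncps_cont_add ncps_cont_compose[OF ncps_cont_subst] ncps_cont_deriv_t
          ncps_cont_derivation D)
  qed (simp add: L_mult R_mult const mono)
  then show ?thesis by (simp add: L_def R_def D_def)
qed

text \<open>The components of F(G) = z are constant in t, so the chain rule makes dF/dt + [u d/dz]F
  vanish after substitution of \<open>G\<close>. The hypotheses are symmetric in \<open>F\<close>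
  and \<open>G\<close>, so the lemma also applies with the roles exchanged.\<close>

lemma ncps_vec_deriv_t_inverse:
  fixes F G :: "('k::idom fps, 'n::finite) ncps ^ 'n"
  assumes F1: "\<And>i. ord_ge 1 (F $ i)" and G1: "\<And>i. ord_ge 1 (G $ i)"
    and FG: "ncps_vec_subst F G = ncps_vars" and GF: "ncps_vec_subst G F = ncps_vars"
  shows "ncps_vec_deriv_t F = - ncps_vec_derivation (ncps_vec_subst (ncps_vec_deriv_t G) F) F"
proof -
  let ?u = "ncps_vec_subst (ncps_vec_deriv_t G) F"
  have u: "ncps_vec_subst ?u G = ncps_vec_deriv_t G"
    by (simp add: ncps_vec_subst_subst[OF F1 G1] FG)
  have "ncps_deriv_t (F $ i) + ncps_derivation ?u (F $ i) = 0" for i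
  proof -
    let ?f = "ncps_deriv_t (F $ i) + ncps_derivation ?u (F $ i)"
    have "ncps_subst (F $ i) G = ncps_var i"
      using FG by (metis ncps_vec_subst_nth ncps_vars_nth)
    then have "ncps_subst ?f G = 0"
      using ncps_deriv_t_subst[OF G1 u, of "F $ i"]
      by (simp add: ncps_deriv_t_var ncps_subst_add)
    \<comment> \<open>Substituting \<open>F\<close> undoes the substitution of \<open>G\<close>,
      since G(F) = z.\<close>
    then have "ncps_subst (ncps_subst ?f G) F = 0"
      using ncps_subst_diff[of 0 0 F] by simp
    then show ?thesis
      by (simp add: ncps_subst_subst[OF G1 F1] GF)
  qed
  then show ?thesis
    by (simp add: vec_eq_iff ncps_vec_derivation_def eq_neg_iff_add_eq_0)
qed

text \<open>The negative of a derivation is a derivation, so uniqueness identifies it from its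
  values on the variables. This absorbs the sign in dF/dt = -dH/dt when that vector directs the
  derivation.\<close>

lemma ncps_vec_derivation_uminus:
  "ncps_vec_derivation (- u) V = - ncps_vec_derivation u V"
proof -
  let ?D = "\<lambda>f. - ncps_derivation u f"
  have D: "ncps_is_derivation (ncps_derivation u)"
    using ncps_derivation_props by blast
  have "ncps_is_derivation ?D"
    unfolding ncps_is_derivation_def
  proof (intro conjI allI)
    show "?D (f + g) = ?D f + ?D g" for f g
      using D by (simp add: ncps_is_derivation_def)
    show "?D (ncps_const c * f) = ncps_const c * ?D f" for c f
      using D by (metis minus_mult_right ncps_is_derivation_def)
    show "?D (f * g) = ?D f * g + f * ?D g" for f g
      using D by (simp add: ncps_is_derivation_def)
  qed
  then have "ncps_derivation (- u) = ?D"
    using ncps_derivation_props[of u] ncps_derivation_props[of "- u"]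
    by (intro ncps_derivation_unique) auto
  then show ?thesis
    by (simp add: vec_eq_iff ncps_vec_derivation_def)
qed

theorem lemma3p1:
  fixes H F G M :: "('k::idom fps, 'n::finite) ncps ^ 'n"
  assumes "ncps_vec_order H \<ge> 2"
    and "F = ncps_vars - H"
    and "G = inverse_map F"
    and "M = G - ncps_vars"
  shows "M = ncps_vec_subst H G \<and>
         H = ncps_vec_subst M F \<and>
         ncps_vec_deriv_t H = ncps_vec_derivation (ncps_vec_subst (ncps_vec_deriv_t M) F) F \<and>
         ncps_vec_deriv_t M = ncps_vec_derivation (ncps_vec_subst (ncps_vec_deriv_t H) G) G"
proof -
  have "enat 2 \<le> ncps_vec_order H"
    using assms(1) by (simp add: numeral_eq_enat)
  then have H2: "ord_ge 2 (H $ i)" for i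
    by (simp add: ncps_vec_order_ge_iff)
  have F1: "ord_ge 1 (F $ i)" for i
    by (simp add: assms(2) ord_ge_diff ord_ge_var[unfolded One_nat_def] ord_ge_mono[OF H2])
  have "is_inverse_map F G"
    using is_inverse_map_inverse_map[OF H2] by (simp add: assms)
  then have G1: "ord_ge 1 (G $ i)" and FG: "ncps_vec_subst F G = ncps_vars"
    and GF: "ncps_vec_subst G F = ncps_vars" for i
    using ncps_vec_order_ge_iff[of 1 G] by (simp_all add: is_inverse_map_def one_enat_def)
  \<comment> \<open>The vector z is constant in t, so passing from \<open>F\<close> to
    \<open>H\<close> only changes a sign and passing from \<open>G\<close> to \<open>M\<close>
    changes nothing.\<close>
  have H: "H = ncps_vars - F" and dF: "ncps_vec_deriv_t F = - ncps_vec_deriv_t H"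
    and dM: "ncps_vec_deriv_t M = ncps_vec_deriv_t G"
    by (simp_all add: assms(2,4) ncps_vec_deriv_t_diff)
  have "M = ncps_vec_subst H G"
    by (simp add: H assms(4) ncps_vec_subst_diff FG ncps_vec_subst_vars_left[OF G1])
  moreover have "H = ncps_vec_subst M F"
    by (simp add: H assms(4) ncps_vec_subst_diff GF ncps_vec_subst_vars_left[OF F1])
  moreover have
    "ncps_vec_deriv_t H = ncps_vec_derivation (ncps_vec_subst (ncps_vec_deriv_t M) F) F"
    using ncps_vec_deriv_t_inverse[OF F1 G1 FG GF] by (simp add: dF dM)
  moreover have
    "ncps_vec_deriv_t M = ncps_vec_derivation (ncps_vec_subst (ncps_vec_deriv_t H) G) G"
  proof -
    \<comment> \<open>With the roles of \<open>F\<close> and \<open>G\<close> exchanged, the minus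
      sign of the inverse formula cancels against the one in dF/dt = -dH/dt, once the latter is
      pulled out of the substitution.\<close>
    have "ncps_vec_subst (ncps_vec_deriv_t F) G = - ncps_vec_subst (ncps_vec_deriv_t H) G"
      using ncps_vec_subst_diff[of 0 "ncps_vec_deriv_t H" G] ncps_vec_subst_diff[of 0 0 G]
      by (simp add: dF)
    then show ?thesis
      using ncps_vec_deriv_t_inverse[OF G1 F1 GF FG] by (simp add: dM ncps_vec_derivation_uminus)
  qed
  ultimately show ?thesis by blast
qed

end
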